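(* Let $L,k,b\ge 1$ be integers, $\lambda_\tau>0$ and $\epsilon_b\in[0,1]$. For the width-expanding (beam-search-like) strategy that samples $k$ steps and keeps $b$ candidates at each of $L$ layers, in the model described in the context, the probability of obtaining a $\tau$-correct response satisfies $$\Pr[\psi(\mathcal R)\le\tau]\ \le\ \epsilon_b^{L}\,k^{L}\,\lambda_\tau^{L}\,e^{-\frac{L(L+1)}{2}}.$$
   Context: A response $\mathcal R=[r_1,\dots,r_L]$ is a sequence of $L$ random reasoning steps. $\phi$ is a real-valued oracle evaluating steps, $r_l^*$ is the golden step at layer $l$, and $\tau\ge 0$. A step $r_l$ is $\tau$-correct if $|\phi(r_l)-\phi(r_l^* )|\le\tau$. The response $\mathcal R$ is $\tau$-correct, written $\psi(\mathcal R)\le\tau$, if all its steps are $\tau$-correct. Modelling assumption: given that the preceding steps are $\tau$-correct, a single sampled step at layer $l$ is $\tau$-correct with probability $p_l=\min(\lambda_\tau e^{-l},1)$, where $\lambda_\tau>0$ is a constant depending on $\tau$. Strategy: at each layer $l=1,\dots,L$, $k$ steps are sampled and $b$ candidates are kept; $\epsilon_b$ is the probability of selecting a $\tau$-correct step from the $b$ candidates. Formally, let $G_l$ be the event that at least one of the $k$ steps sampled at layer $l$ is $\tau$-correct and $S_l\subseteq G_l$ the event that the step selected at layer $l$ is $\tau$-correct. Conditionally on $S_1\cap\dots\cap S_{l-1}$, the $k$ samples at layer $l$ are independent, each $\tau$-correct with probability $p_l$, and $\Pr[S_l\mid S_1\cap\dots\cap S_{l-1}\cap G_l]=\epsilon_b$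 (whenever the conditioning events have positive probability). The obtained response is $\tau$-correct iff $S_1\cap\dots\cap S_L$ occurs. *)

theory Defs
  imports "HOL-Probability.Probability"
begin

definition step_correct :: "('r \<Rightarrow> real) \<Rightarrow> (nat \<Rightarrow> 'r) \<Rightarrow> real \<Rightarrow> nat \<Rightarrow> 'r \<Rightarrow> bool" where
  "step_correct \<phi> gold \<tau> l r \<longleftrightarrow> \<bar>\<phi> r - \<phi> (gold l)\<bar> \<le> \<tau>"

text \<open>The relation written \<open>\<psi>(R) \<le> \<tau>\<close> for a response \<open>R = [r_1, ..., r_L]\<close>.
  Layers are numbered from 1, list positions from 0.\<close>

definition response_correct :: "('r \<Rightarrow> real) \<Rightarrow> (nat \<Rightarrow> 'r) \<Rightarrow> real \<Rightarrow> 'r list \<Rightarrow> bool" where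
  "response_correct \<phi> gold \<tau> rs \<longleftrightarrow>
     (\<forall>i<length rs. step_correct \<phi> gold \<tau> (Suc i) (rs ! i))"

definition step_prob :: "real \<Rightarrow> nat \<Rightarrow> real" where
  "step_prob c l = min (c * exp (- real l)) 1"

text \<open>
  \<open>X l j\<close> is the \<open>j\<close>-th of the \<open>k\<close> steps sampled at layer \<open>l\<close>, and \<open>R l\<close> is the step selected at
  layer \<open>l\<close>; both are random elements of the measurable space \<open>N\<close> of steps.
  \<open>lam \<tau>\<close> is the constant depending on \<open>\<tau>\<close>, and \<open>\<epsilon> b\<close> is the probability of
  selecting a correct step from \<open>b\<close> candidates. The number \<open>b\<close> enters only through \<open>\<epsilon> b\<close>.

  Conditioning on an event \<open>A\<close> of positive probability means passing to \<open>uniform_measure M A\<close>,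
  that is, to the measure mapping \<open>B\<close> to \<open>P(A \<inter> B) / P(A)\<close>.
\<close>

locale width_expanding = prob_space M
  for M :: "'w measure" +
  fixes N :: "'r measure"
    and \<phi> :: "'r \<Rightarrow> real"
    and gold :: "nat \<Rightarrow> 'r"
    and \<tau> :: real
    and lam :: "real \<Rightarrow> real"
    and \<epsilon> :: "nat \<Rightarrow> real"
    and L k b :: nat
    and X :: "nat \<Rightarrow> nat \<Rightarrow> 'w \<Rightarrow> 'r"
    and R :: "nat \<Rightarrow> 'w \<Rightarrow> 'r"
    and S G Pre :: "nat \<Rightarrow> 'w set"
  defines "S \<equiv> \<lambda>l. {\<omega> \<in> space M. step_correct \<phi> gold \<tau> l (R l \<omega>)}"
    and "G \<equiv> \<lambda>l. {\<omega> \<in> space M. \<exists>j\<in>{1..k}. step_correct \<phi> gold \<tau> l (X l j \<omega>)}"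
    and "Pre \<equiv> \<lambda>l. {\<omega> \<in> space M. \<forall>i\<in>{1..<l}. \<omega> \<in> S i}"
  assumes oracle_measurable: "\<phi> \<in> borel_measurable N"
    and sample_measurable: "\<And>l j. l \<in> {1..L} \<Longrightarrow> j \<in> {1..k} \<Longrightarrow> random_variable N (X l j)"
    and selected_measurable: "\<And>l. l \<in> {1..L} \<Longrightarrow> random_variable N (R l)"
    and selected_subset: "\<And>l. l \<in> {1..L} \<Longrightarrow> S l \<subseteq> G l"
    and samples_indep: "\<And>l. l \<in> {1..L} \<Longrightarrow> prob (Pre l) > 0 \<Longrightarrow>
          prob_space.indep_vars (uniform_measure M (Pre l)) (\<lambda>_. N) (X l) {1..k}"
    and samples_prob: "\<And>l j. l \<in> {1..L} \<Longrightarrow> j \<in> {1..k} \<Longrightarrow> prob (Pre l) > 0 \<Longrightarrow>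
          measure (uniform_measure M (Pre l))
            {\<omega> \<in> space M. step_correct \<phi> gold \<tau> l (X l j \<omega>)} = step_prob (lam \<tau>) l"
    and selection_prob: "\<And>l. l \<in> {1..L} \<Longrightarrow> prob (Pre l \<inter> G l) > 0 \<Longrightarrow>
          measure (uniform_measure M (Pre l \<inter> G l)) (S l) = \<epsilon> b"

end

theory Submission imports Defs
begin

text \<open>
  By a union bound, at least one of the \<open>k\<close> samples at layer \<open>l\<close> is correct with conditional
  probability at most \<open>k * lam \<tau> * exp (- l)\<close>, so each layer contributes a factor of at most
  \<open>\<epsilon> b * k * lam \<tau> * exp (- l)\<close>, and the exponents add up to \<open>L * (L + 1) / 2\<close>.
\<close>

text \<open>The multiplication rule, which turns the conditional assumptions of the model, phrased
  with \<open>uniform_measure\<close>, into unconditional probabilities of intersections.\<close>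

lemma (in prob_space) prob_Int_eq_uniform_measure:
  assumes "A \<in> events" and "B \<in> events" and "prob A > 0"
  shows "prob (A \<inter> B) = measure (uniform_measure M A) B * prob A"
proof -
  have "emeasure M A \<noteq> 0"
    using assms(3) by (simp add: emeasure_eq_measure)
  then have "measure (uniform_measure M A) B = prob (A \<inter> B) / prob A"
    using assms(2) by (intro measure_uniform_measure) auto
  then show ?thesis
    using assms(3) by simp
qed

context width_expanding
begin

lemma step_correct_event:
  assumes "random_variable N Y"
  shows "{\<omega> \<in> space M. step_correct \<phi> gold \<tau> l (Y \<omega>)} \<in> events"
proof -
  have [measurable]: "(\<lambda>\<omega>. \<phi> (Y \<omega>)) \<in> borel_measurable M"
    using assms oracle_measurable by (rule measurable_compose)
  show ?thesis
    unfolding step_correct_def by measurable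
qed

lemma S_event: "l \<in> {1..L} \<Longrightarrow> S l \<in> events"
  unfolding S_def by (intro step_correct_event selected_measurable)

lemma G_eq: "G l = (\<Union>j\<in>{1..k}. {\<omega> \<in> space M. step_correct \<phi> gold \<tau> l (X l j \<omega>)})"
  unfolding G_def by auto

lemma G_event: "l \<in> {1..L} \<Longrightarrow> G l \<in> events"
  unfolding G_eq by (intro sets.finite_UN step_correct_event sample_measurable) auto

text \<open>Layers start at 1, so \<open>l = 0\<close> is excluded: \<open>Pre (Suc 0)\<close> is
  the whole space and \<open>S 0\<close> must not enter.\<close>

lemma Pre_Suc: "l \<ge> 1 \<Longrightarrow> Pre (Suc l) = Pre l \<inter> S l"
  unfolding Pre_def by (auto simp: S_def less_Suc_eq)

lemma Pre_1: "Pre (Suc 0) = space M"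
  unfolding Pre_def by auto

lemma Pre_event: "l \<in> {1..L} \<Longrightarrow> Pre l \<in> events"
proof (induction l)
  case (Suc l)
  then show ?case
    by (cases "l = 0") (simp_all add: Pre_1 Pre_Suc sets.Int S_event)
qed simp

lemma prob_Pre_G_le:
  assumes l: "l \<in> {1..L}"
  shows "prob (Pre l \<inter> G l) \<le> real k * step_prob (lam \<tau>) l * prob (Pre l)"
proof -
  let ?C = "\<lambda>j. {\<omega> \<in> space M. step_correct \<phi> gold \<tau> l (X l j \<omega>)}"
  have Pre: "Pre l \<in> events"
    using l by (rule Pre_event)
  have C: "?C j \<in> events" if "j \<in> {1..k}" for j
    by (rule step_correct_event[OF sample_measurable[OF l that]])
  show ?thesis
  proof (cases "prob (Pre l) > 0")
    case True
    have "prob (Pre l \<inter> G l) = prob (\<Union>j\<in>{1..k}. Pre l \<inter> ?C j)"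
      by (simp only: G_eq Int_UN_distrib)
    also have "\<dots> \<le> (\<Sum>j\<in>{1..k}. prob (Pre l \<inter> ?C j))"
      using Pre C by (intro finite_measure_subadditive_finite) auto
    also have "\<dots> = (\<Sum>j\<in>{1..k}. step_prob (lam \<tau>) l * prob (Pre l))"
    proof (rule sum.cong)
      fix j
      assume j: "j \<in> {1..k}"
      show "prob (Pre l \<inter> ?C j) = step_prob (lam \<tau>) l * prob (Pre l)"
        unfolding prob_Int_eq_uniform_measure[OF Pre C[OF j] True] samples_prob[OF l j True] ..
    qed simp
    finally show ?thesis by simp
  next
    \<comment> \<open>The history is null, so both sides vanish.\<close>
    case False
    then have "prob (Pre l) = 0"
      using measure_nonneg[of M "Pre l"] by linarith
    moreover have "prob (Pre l \<inter> G l) \<le> prob (Pre l)"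
      using Pre by (intro finite_measure_mono) auto
    ultimately show ?thesis by simp
  qed
qed

text \<open>A correct selection forces a correct sample, so surviving layer \<open>l\<close> splits
  into two stages: first \<open>G l\<close>, then the selection, which has conditional probability
  \<open>\<epsilon> b\<close>. If \<open>Pre l \<inter> G l\<close> is null, both sides are
  0.\<close>

lemma prob_Pre_Suc:
  assumes l: "l \<in> {1..L}"
  shows "prob (Pre (Suc l)) = \<epsilon> b * prob (Pre l \<inter> G l)"
proof -
  have Pre_G: "Pre l \<inter> G l \<in> events"
    using Pre_event[OF l] G_event[OF l] by auto
  have eq: "Pre (Suc l) = (Pre l \<inter> G l) \<inter> S l"
    using Pre_Suc[of l] selected_subset[OF l] l by fastforce
  show ?thesis
  proof (cases "prob (Pre l \<inter> G l) > 0")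
    case True
    then show ?thesis
      unfolding eq prob_Int_eq_uniform_measure[OF Pre_G S_event[OF l] True]
      by (simp only: selection_prob[OF l True])
  next
    case False
    then have "prob (Pre l \<inter> G l) = 0"
      using measure_nonneg[of M "Pre l \<inter> G l"] by linarith
    moreover have "prob (Pre (Suc l)) \<le> prob (Pre l \<inter> G l)"
      unfolding eq using Pre_G by (intro finite_measure_mono) auto
    ultimately show ?thesis
      using measure_nonneg[of M "Pre (Suc l)"] by simp
  qed
qed

text \<open>Induction over the layers, chaining the two one-layer estimates. The index is shifted
  because \<open>Pre (Suc n)\<close> concerns layers 1 to \<open>n\<close>.\<close>

lemma prob_Pre_le:
  assumes "0 \<le> \<epsilon> b" and "0 \<le> lam \<tau>" and "n \<le> L"
  shows "prob (Pre (Suc n))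
    \<le> \<epsilon> b ^ n * real k ^ n * lam \<tau> ^ n * exp (- (real n * (real n + 1) / 2))"
  using assms(3)
proof (induction n)
  case 0
  then show ?case by simp
next
  case (Suc n)
  let ?B = "\<epsilon> b ^ n * real k ^ n * lam \<tau> ^ n * exp (- (real n * (real n + 1) / 2))"
  have l: "Suc n \<in> {1..L}"
    using Suc.prems by simp
  have "prob (Pre (Suc (Suc n))) \<le> \<epsilon> b * (real k * step_prob (lam \<tau>) (Suc n) * prob (Pre (Suc n)))"
    unfolding prob_Pre_Suc[OF l] using prob_Pre_G_le[OF l] assms(1) by (rule mult_left_mono)
  \<comment> \<open>Dropping the cap 1 from \<open>step_prob\<close> only enlarges the bound; the
    last factor is the induction hypothesis.\<close>
  also have "\<dots> \<le> \<epsilon> b * (real k * (lam \<tau> * exp (- real (Suc n))) * ?B)"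
    using Suc.IH Suc.prems assms(1,2)
    by (intro mult_left_mono mult_mono) (simp_all add: step_prob_def)
  also have "\<dots> = \<epsilon> b ^ Suc n * real k ^ Suc n * lam \<tau> ^ Suc n
      * (exp (- real (Suc n)) * exp (- (real n * (real n + 1) / 2)))"
    by (simp only: power_Suc mult_ac)
  \<comment> \<open>The triangular numbers: n(n+1)/2 + (n+1) = (n+1)(n+2)/2.\<close>
  also have "exp (- real (Suc n)) * exp (- (real n * (real n + 1) / 2))
      = exp (- (real (Suc n) * (real (Suc n) + 1) / 2))"
    unfolding exp_add[symmetric] by (simp add: field_simps)
  finally show ?case .
qed

text \<open>List position \<open>i\<close> holds the step of layer \<open>Suc i\<close>; the shift
  carries positions below \<open>L\<close> onto layers 1 to \<open>L\<close>.\<close>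

lemma response_correct_eq_Pre:
  "{\<omega> \<in> space M. response_correct \<phi> gold \<tau> (map (\<lambda>l. R l \<omega>) [1..<Suc L])} = Pre (Suc L)"
proof -
  have "(\<forall>i<L. P (Suc i)) \<longleftrightarrow> (\<forall>i\<in>Suc ` {..<L}. P i)" for P
    by blast
  also have "Suc ` {..<L} = {1..<Suc L}"
    by (simp only: lessThan_atLeast0 image_Suc_atLeastLessThan One_nat_def)
  finally have iff: "(\<forall>i<L. P (Suc i)) \<longleftrightarrow> (\<forall>i\<in>{1..<Suc L}. P i)" for P .
  have "response_correct \<phi> gold \<tau> (map (\<lambda>l. R l \<omega>) [1..<Suc L])
      \<longleftrightarrow> (\<forall>i\<in>{1..<Suc L}. step_correct \<phi> gold \<tau> i (R i \<omega>))" for \<omega>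
    \<comment> \<open>Without \<open>upt_Suc\<close> the interval list stays whole, so its entries
      can be read off by index.\<close>
    unfolding response_correct_def iff[symmetric] by (simp del: upt_Suc)
  then show ?thesis
    unfolding Pre_def S_def by blast
qed

end

theorem theorem4p6:
  fixes M :: "'w measure" and N :: "'r measure"
    and \<phi> :: "'r \<Rightarrow> real" and gold :: "nat \<Rightarrow> 'r" and \<tau> :: real
    and lam :: "real \<Rightarrow> real" and \<epsilon> :: "nat \<Rightarrow> real" and L k b :: nat
    and X :: "nat \<Rightarrow> nat \<Rightarrow> 'w \<Rightarrow> 'r" and R :: "nat \<Rightarrow> 'w \<Rightarrow> 'r"
  assumes "L \<ge> 1" and "k \<ge> 1" and "b \<ge> 1"
    and "\<tau> \<ge> 0" and "lam \<tau> > 0" and "0 \<le> \<epsilon> b" and "\<epsilon> b \<le> 1"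
    and "width_expanding M N \<phi> gold \<tau> lam \<epsilon> L k b X R"
  shows "measure M {\<omega> \<in> space M. response_correct \<phi> gold \<tau> (map (\<lambda>l. R l \<omega>) [1..<Suc L])}
    \<le> \<epsilon> b ^ L * real k ^ L * lam \<tau> ^ L * exp (- (real L * (real L + 1) / 2))"
proof -
  \<comment> \<open>\<open>S\<close>, \<open>G\<close> and \<open>Pre\<close> come from
    \<open>defines\<close> and are not arguments of the locale predicate, so their bodies are
    supplied here.\<close>
  interpret width_expanding M N \<phi> gold \<tau> lam \<epsilon> L k b X R
    "\<lambda>l. {\<omega> \<in> space M. step_correct \<phi> gold \<tau> l (R l \<omega>)}"
    "\<lambda>l. {\<omega> \<in> space M. \<exists>j\<in>{1..k}. step_correct \<phi> gold \<tau> l (X l j \<omega>)}"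
    "\<lambda>l. {\<omega> \<in> space M. \<forall>i\<in>{1..<l}. \<omega> \<in> {\<omega> \<in> space M. step_correct \<phi> gold \<tau> i (R i \<omega>)}}"
    using assms(8) by simp_all
  show ?thesis
    unfolding response_correct_eq_Pre using assms(5,6) by (intro prob_Pre_le) auto
qed

end
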